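(* Suppose that $s \ge 3$ and that a sequence of finite $s$-uniform hypergraphs $\mathcal{H} = \mathcal{H}_n$ with $v(\mathcal{H}) \to \infty$ satisfies $\Delta_2(\mathcal{H}) = O(1)$. There is a positive constant $c$ such that, for every sequence $p = p_n \in [0,1]$ with $p \le c \cdot v(\mathcal{H})^{-1/(s-1)}$, letting $V = V(\mathcal{H})$, \[ \Pr\big(\mathcal{H}[V_p] \text{ is } 2\text{-choosable}\big) \to 1 . \]
   Context: $v(\mathcal{H})$ is the number of vertices of $\mathcal{H}$. $\Delta_2(\mathcal{H})$ is the maximum, over all pairs of distinct vertices, of the number of edges of $\mathcal{H}$ containing both. $V_p$ is the random subset of $V$ obtained by retaining each element independently with probability $p$, and $\mathcal{H}[V_p]$ is the subhypergraph of $\mathcal{H}$ induced by $V_p$. A hypergraph $\mathcal{G}$ is $2$-choosable if, for every assignment of two-element lists of colours to its vertices, there is a colouring of the vertices, giving each vertex a colour from its list, in which no edge is monochromatic. *)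

theory Defs
  imports "HOL-Probability.Product_PMF" "HOL-Library.Landau_Symbols"
begin

type_synonym 'a hypergraph = "'a set \<times> 'a set set"

abbreviation verts :: "'a hypergraph \<Rightarrow> 'a set" where
  "verts H \<equiv> fst H"

abbreviation edges :: "'a hypergraph \<Rightarrow> 'a set set" where
  "edges H \<equiv> snd H"

definition finite_uniform_hypergraph :: "nat \<Rightarrow> 'a hypergraph \<Rightarrow> bool" where
  "finite_uniform_hypergraph s H \<longleftrightarrow>
     finite (verts H) \<and> (\<forall>e\<in>edges H. e \<subseteq> verts H \<and> card e = s)"

(* The inserted 0 only gives the value for hypergraphs with fewer than two vertices. *)
definition max_codegree :: "'a hypergraph \<Rightarrow> nat" where
  "max_codegree H =
     Max (insert 0 {card {e \<in> edges H. u \<in> e \<and> v \<in> e} | u v.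
       u \<in> verts H \<and> v \<in> verts H \<and> u \<noteq> v})"

definition induced :: "'a hypergraph \<Rightarrow> 'a set \<Rightarrow> 'a hypergraph" where
  "induced H W = (W, {e \<in> edges H. e \<subseteq> W})"

definition monochromatic :: "('a \<Rightarrow> 'c) \<Rightarrow> 'a set \<Rightarrow> bool" where
  "monochromatic f e \<longleftrightarrow> (\<exists>c. \<forall>v\<in>e. f v = c)"

(* Colours are natural numbers: a finite hypergraph with finite lists uses only finitely
   many colours, so any infinite set of colours gives the same notion. *)
definition choosable :: "nat \<Rightarrow> 'a hypergraph \<Rightarrow> bool" where
  "choosable k H \<longleftrightarrow>
     (\<forall>L :: 'a \<Rightarrow> nat set. (\<forall>v\<in>verts H. finite (L v) \<and> card (L v) = k) \<longrightarrow>
        (\<exists>f. (\<forall>v\<in>verts H. f v \<in> L v) \<and> (\<forall>e\<in>edges H. \<not> monochromatic f e)))"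

(* The law of V_p, for finite V and 0 \<le> p \<le> 1. *)
definition random_subset :: "'a set \<Rightarrow> real \<Rightarrow> 'a set pmf" where
  "random_subset V p =
     map_pmf (\<lambda>X. {v \<in> V. X v}) (Pi_pmf V False (\<lambda>_. bernoulli_pmf p))"

end

theory Submission imports Defs "HOL-Real_Asymp.Real_Asymp"
begin

text \<open>
  Write \<open>s = r + 1\<close> and explore a hypergraph edge by edge from a single vertex. A \<^emph>\<open>tree\<close> step adds
  an edge meeting the explored set \<open>W\<close> in one vertex, an \<^emph>\<open>excess\<close> step one meeting it in at least
  two vertices but not contained in it; after \<open>T\<close> tree steps \<open>card W = 1 + r * T + k\<close>, where \<open>k\<close> counts
  the vertices gained in excess steps. If \<open>p\<close> is at most a small multiple of \<open>v(H)\<close> to the power \<open>-1/r\<close>,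
  each tree step multiplies the expected number of explored sets inside the random set by a small
  constant, provided that it starts in the part added since the last tree step (so that there are
  boundedly many choices for its vertex), and each new excess vertex multiplies it by \<open>p\<close>, up to a
  factor polynomial in \<open>T\<close>. Hence with high probability no exploration reaches \<open>k \<ge> r\<close>.

  If all explorations have \<open>k < r\<close>, consider an edge-minimal set of edges that is not colourable from
  the given lists. Alternate tree steps with exhaustive sequences of excess steps. A round then
  adds a set \<open>N\<close>, and every edge inside the explored set which meets \<open>N\<close> has at least \<open>r\<close> vertices
  in \<open>N\<close>. If \<open>card N \<le> 2 * r - 2\<close>, then \<open>N\<close> can be coloured with all colour classes of size at most
  \<open>r - 1\<close>, so by minimality some edge must leave the explored set at a vertex of \<open>N\<close>, and the
  exploration goes on forever, which is absurd. The bound on \<open>card N\<close> follows from \<open>k < r\<close> if \<open>k > 0\<close>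
  from the start, that is, if the exploration starts with two edges sharing at least two vertices.
  If there are no such edges, the only other case is a round that closes a cycle, in which \<open>N\<close> is met
  by at most three edges and is coloured by hand.
\<close>

section \<open>Exploring a hypergraph\<close>

text \<open>In \<open>explored E V T X W P\<close> the numbers \<open>T\<close> and \<open>X\<close> count the tree and excess steps, and \<open>P\<close>
  consists of the last tree edge and the vertices found after it.\<close>

inductive explored :: "'a set set \<Rightarrow> 'a set \<Rightarrow> nat \<Rightarrow> nat \<Rightarrow> 'a set \<Rightarrow> 'a set \<Rightarrow> bool"
  for E :: "'a set set" and V :: "'a set" where
  start: "v \<in> V \<Longrightarrow> explored E V 0 0 {v} {v}"
| tree: "explored E V T X W P \<Longrightarrow> w \<in> P \<Longrightarrow> e \<in> E \<Longrightarrow> e \<inter> W = {w}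
    \<Longrightarrow> explored E V (Suc T) X (W \<union> e) e"
| excess: "explored E V T X W P \<Longrightarrow> e \<in> E \<Longrightarrow> \<not> e \<subseteq> W \<Longrightarrow> u \<in> e \<inter> W \<Longrightarrow> v \<in> e \<inter> W \<Longrightarrow> u \<noteq> v
    \<Longrightarrow> explored E V T (Suc X) (W \<union> e) (P \<union> (e - W))"

text \<open>Carries explorations of a minimal set of edges, or of an induced subhypergraph, over to
  the whole hypergraph, where they are counted.\<close>

lemma explored_mono:
  assumes "explored E V T X W P" "E \<subseteq> E'" "V \<subseteq> V'"
  shows "explored E' V' T X W P"
  using assms by (induction rule: explored.induct) (auto intro: explored.intros)

text \<open>For finite edges this says that no excess step leads out of \<open>W\<close>.\<close>

definition closed_under :: "'a set set \<Rightarrow> 'a set \<Rightarrow> bool" where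
  "closed_under E W \<longleftrightarrow> (\<forall>e\<in>E. e \<subseteq> W \<or> card (e \<inter> W) \<le> 1)"

definition list_coloring :: "('a \<Rightarrow> nat set) \<Rightarrow> 'a set \<Rightarrow> 'a set set \<Rightarrow> ('a \<Rightarrow> nat) \<Rightarrow> bool" where
  "list_coloring L V E f \<longleftrightarrow> (\<forall>v\<in>V. f v \<in> L v) \<and> (\<forall>e\<in>E. \<not> monochromatic f e)"

section \<open>Colouring with small colour classes\<close>

lemma other_element:
  assumes "card A = 2"
  obtains b where "b \<in> A" "b \<noteq> (a :: 'b)"
proof -
  have "\<not> A \<subseteq> {a}"
    using assms by (auto simp: subset_singleton_iff)
  then show ?thesis using that by auto
qed

text \<open>If the class of \<open>a\<close> has more than \<open>m\<close> vertices, keep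
  \<open>a\<close> on \<open>m\<close> of them and switch the rest of the class to their second
  colours. Every other class then lies among the at most \<open>m\<close> vertices of
  \<open>N\<close> that were not kept.\<close>

lemma cap_color_classes:
  fixes L :: "'a \<Rightarrow> 'c set"
  assumes "finite N" and small: "card N \<le> 2 * m"
    and L: "\<And>v. v \<in> N \<Longrightarrow> card (L v) = 2" and f: "\<And>v. v \<in> N \<Longrightarrow> f v \<in> L v"
  obtains g where "\<And>v. v \<notin> N \<Longrightarrow> g v = f v" "\<And>v. v \<in> N \<Longrightarrow> g v \<in> L v"
    "\<And>a. card {v \<in> N. g v = a} \<le> m"
proof (cases "\<forall>a. card {v \<in> N. f v = a} \<le> m")
  case True
  then show ?thesis using that[of f] f by auto
next
  case False
  then obtain a where a: "card {v \<in> N. f v = a} > m" by (auto simp: not_le)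
  let ?A = "{v \<in> N. f v = a}"
  obtain B where B: "B \<subseteq> ?A" "card B = m"
    using obtain_subset_with_card_n[OF less_imp_le[OF a]] by blast
  have "\<forall>v\<in>N. \<exists>b\<in>L v. b \<noteq> a"
    using L other_element by metis
  then obtain h where h: "\<And>v. v \<in> N \<Longrightarrow> h v \<in> L v \<and> h v \<noteq> a" by metis
  define g where "g v = (if v \<in> ?A - B then h v else f v)" for v
  have "card {v \<in> N. g v = b} \<le> m" for b
  proof (cases "b = a")
    case True
    have "{v \<in> N. g v = b} \<subseteq> B"
      using h True by (auto simp: g_def split: if_splits)
    moreover have "finite B" using B \<open>finite N\<close> by (auto intro: finite_subset)
    ultimately show ?thesis using B(2) card_mono by blast
  next
    case False
    have "{v \<in> N. g v = b} \<subseteq> N - B"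
      using False B by (auto simp: g_def split: if_splits)
    then have "card {v \<in> N. g v = b} \<le> card (N - B)"
      using \<open>finite N\<close> by (intro card_mono) auto
    also have "\<dots> \<le> m"
      using B small \<open>finite N\<close> by (subst card_Diff_subset) (auto intro: finite_subset)
    finally show ?thesis .
  qed
  then show ?thesis using that[of g] f h by (auto simp: g_def)
qed

section \<open>Sizes of explored sets\<close>

locale uniform_edges =
  fixes V :: "'a set" and E :: "'a set set" and r :: nat
  assumes finite_V: "finite V" and edge_subset: "e \<in> E \<Longrightarrow> e \<subseteq> V"
    and edge_card: "e \<in> E \<Longrightarrow> card e = Suc r" and r_ge: "r \<ge> 2"
begin

lemma finite_edge: "e \<in> E \<Longrightarrow> finite e"
  using edge_subset finite_V finite_subset by blast

lemma finite_E: "finite E"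
  using edge_subset finite_V by (meson Pow_iff finite_Pow_iff finite_subset subsetI)

lemma explored_subset:
  "explored E V T X W P \<Longrightarrow> P \<subseteq> W \<and> W \<subseteq> V"
  by (induction rule: explored.induct) (use edge_subset in blast)+

lemma explored_finite:
  "explored E V T X W P \<Longrightarrow> finite W" "explored E V T X W P \<Longrightarrow> finite P"
  using explored_subset finite_V finite_subset by metis+

lemma card_tree_step:
  assumes "finite W" "e \<in> E" "e \<inter> W = {w}"
  shows "card (W \<union> e) = card W + r"
  using card_Un_Int[of W e] assms finite_edge edge_card by (simp add: Int_commute)

lemma card_excess_step:
  assumes "finite W" "\<not> e \<subseteq> W" "e \<in> E"
  shows "card W < card (W \<union> e)"
  using assms finite_edge by (intro psubset_card_mono) auto

lemma explored_card_ge: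
  "explored E V T X W P \<Longrightarrow> r * T + X + 1 \<le> card W"
proof (induction rule: explored.induct)
  case (tree T X W P w e)
  then show ?case using card_tree_step[of W e w] explored_finite[OF tree(1)] by simp
next
  case (excess T X W P e u v)
  then show ?case using card_excess_step[of W e] explored_finite[OF excess(1)] by simp
qed simp

lemma explored_card_le:
  "explored E V T X W P \<Longrightarrow> card W \<le> 1 + Suc r * (T + X)"
proof (induction rule: explored.induct)
  case (tree T X W P w e)
  then show ?case using card_Un_le[of W e] edge_card[of e] by simp
next
  case (excess T X W P e u v)
  then show ?case using card_Un_le[of W e] edge_card[of e] by simp
qed simp

text \<open>A tree step resets \<open>P\<close> to a single edge, so the bound does not grow with
  \<open>T\<close>; this leaves boundedly many attaching vertices for each tree step.\<close>

lemma explored_front_card_le: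
  "explored E V T X W P \<Longrightarrow> card P \<le> Suc r * Suc X"
proof (induction rule: explored.induct)
  case (tree T X W P w e)
  then show ?case using edge_card[of e] by simp
next
  case (excess T X W P e u v)
  have "card (P \<union> (e - W)) \<le> card P + card e"
    using card_Un_le[of P "e - W"] card_mono[of e "e - W"] finite_edge[OF excess(2)]
    by (meson Diff_subset add_left_mono order_trans)
  then show ?case using excess edge_card[of e] by simp
qed simp

lemma not_closedE:
  assumes "\<not> closed_under E W"
  obtains e u v where "e \<in> E" "\<not> e \<subseteq> W" "u \<in> e \<inter> W" "v \<in> e \<inter> W" "u \<noteq> v"
proof -
  obtain e where e: "e \<in> E" "\<not> e \<subseteq> W" "\<not> card (e \<inter> W) \<le> 1"
    using assms by (auto simp: closed_under_def)
  have "finite (e \<inter> W)" using finite_edge e by auto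
  then obtain u v where "u \<in> e \<inter> W" "v \<in> e \<inter> W" "u \<noteq> v"
    using e(3) by (metis One_nat_def card_le_Suc0_iff_eq)
  then show ?thesis using that e by blast
qed

text \<open>Excess steps enlarge \<open>W\<close> inside the finite set \<open>V\<close>, so they
  run out; all vertices found on the way join the front.\<close>

lemma saturate:
  assumes "explored E V T X W P"
  shows "\<exists>X' W'. explored E V T X' W' (P \<union> (W' - W)) \<and> W \<subseteq> W' \<and> closed_under E W'"
  using assms
proof (induction "card V - card W" arbitrary: X W P rule: less_induct)
  case less
  show ?case
  proof (cases "closed_under E W")
    case True
    then show ?thesis using less.prems by (intro exI[of _ X] exI[of _ W]) auto
  next
    case False
    then obtain e u v where e: "e \<in> E" "\<not> e \<subseteq> W" "u \<in> e \<inter> W" "v \<in> e \<inter> W" "u \<noteq> v"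
      by (rule not_closedE)
    have ex: "explored E V T (Suc X) (W \<union> e) (P \<union> (e - W))"
      using explored.excess[OF less.prems e] .
    have "card W < card (W \<union> e)"
      using card_excess_step explored_finite[OF less.prems] e by blast
    moreover have "card (W \<union> e) \<le> card V"
      using explored_subset[OF ex] finite_V by (intro card_mono) auto
    ultimately have "card V - card (W \<union> e) < card V - card W" by linarith
    from less.hyps[OF this ex] obtain X' W' where
      *: "explored E V T X' W' (P \<union> (e - W) \<union> (W' - (W \<union> e)))" "W \<union> e \<subseteq> W'" "closed_under E W'"
      by blast
    have "P \<union> (e - W) \<union> (W' - (W \<union> e)) = P \<union> (W' - W)" using *(2) by blast
    then show ?thesis using * by (metis le_sup_iff)
  qed
qed

end

section \<open>Critical hypergraphs have dense explored sets\<close>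

text \<open>The situation to be refuted. With \<open>card W = 1 + r * T + k\<close>, the assumption
  \<open>sparse\<close> says \<open>k < r\<close>.\<close>

locale critical_edges = uniform_edges +
  fixes L :: "'a \<Rightarrow> nat set"
  assumes L: "v \<in> V \<Longrightarrow> card (L v) = 2"
    and not_colorable: "\<nexists>f. list_coloring L V E f"
    and critical: "E' \<subset> E \<Longrightarrow> \<exists>f. list_coloring L V E' f"
    and sparse: "explored E V T X W P \<Longrightarrow> card W \<le> r * Suc T"
begin

text \<open>Otherwise closedness puts every edge meeting \<open>N\<close> inside \<open>W\<close>.
  Criticality colours the edges avoiding \<open>N\<close>, and recolouring only \<open>N\<close> as
  in \<open>ext\<close> leaves those edges untouched, so all of \<open>E\<close> would be
  colourable.\<close>

lemma tree_edge_at: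
  assumes N: "N \<subseteq> W" "W \<subseteq> V" and "closed_under E W" and e: "e \<in> E" "e \<inter> N \<noteq> {}"
    and ext: "\<And>f. \<lbrakk>list_coloring L V {g \<in> E. g \<inter> N = {}} f;
        \<forall>g\<in>E. g \<inter> N \<noteq> {} \<longrightarrow> g \<subseteq> W\<rbrakk> \<Longrightarrow>
      \<exists>f'. (\<forall>v. v \<notin> N \<longrightarrow> f' v = f v) \<and> (\<forall>v\<in>N. f' v \<in> L v) \<and>
        (\<forall>g\<in>E. g \<inter> N \<noteq> {} \<longrightarrow> \<not> monochromatic f' g)"
  shows "\<exists>w\<in>N. \<exists>g\<in>E. g \<inter> W = {w}"
proof (rule ccontr)
  assume no: "\<not> ?thesis"
  have inside: "\<forall>g\<in>E. g \<inter> N \<noteq> {} \<longrightarrow> g \<subseteq> W"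
  proof (intro ballI impI, rule ccontr)
    fix g assume g: "g \<in> E" "g \<inter> N \<noteq> {}"
    assume "\<not> g \<subseteq> W"
    then have "card (g \<inter> W) \<le> 1" using assms(3) g by (auto simp: closed_under_def)
    moreover obtain w where w: "w \<in> g" "w \<in> N" using g by auto
    ultimately have "g \<inter> W = {w}"
      using N finite_edge[OF g(1)] card_le_Suc0_iff_eq[of "g \<inter> W"] by auto
    then show False using no w g by blast
  qed
  have "{g \<in> E. g \<inter> N = {}} \<subset> E" using e by blast
  then obtain f where f: "list_coloring L V {g \<in> E. g \<inter> N = {}} f"
    using critical by blast
  obtain f' where f': "(\<forall>v. v \<notin> N \<longrightarrow> f' v = f v) \<and> (\<forall>v\<in>N. f' v \<in> L v) \<and>
      (\<forall>g\<in>E. g \<inter> N \<noteq> {} \<longrightarrow> \<not> monochromatic f' g)"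
    using ext[OF f inside] by (rule exE)
  have "\<not> monochromatic f' g" if g: "g \<in> E" for g
  proof (cases "g \<inter> N = {}")
    case True
    then have "\<forall>v\<in>g. f' v = f v" using f' by blast
    then have "monochromatic f' g = monochromatic f g" by (auto simp: monochromatic_def)
    then show ?thesis using f g True by (auto simp: list_coloring_def)
  qed (use f' g in blast)
  moreover have "f' v \<in> L v" if "v \<in> V" for v
    using f' f that by (cases "v \<in> N") (auto simp: list_coloring_def)
  ultimately show False using not_colorable unfolding list_coloring_def by blast
qed

text \<open>Recolour \<open>N\<close> with classes of size at most \<open>m\<close>: an edge with
  more than \<open>m\<close> vertices in \<open>N\<close> cannot be monochromatic.\<close>

lemma tree_edge_at_small:
  assumes N: "N \<subseteq> W" "W \<subseteq> V" and "closed_under E W" and e: "e \<in> E" "e \<inter> N \<noteq> {}"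
    and small: "card N \<le> 2 * m"
    and large: "\<And>g. g \<in> E \<Longrightarrow> g \<inter> N \<noteq> {} \<Longrightarrow> g \<subseteq> W \<Longrightarrow> m < card (g \<inter> N)"
  shows "\<exists>w\<in>N. \<exists>g\<in>E. g \<inter> W = {w}"
proof (rule tree_edge_at[OF assms(1-5)])
  fix f assume f: "list_coloring L V {g \<in> E. g \<inter> N = {}} f"
    and inside: "\<forall>g\<in>E. g \<inter> N \<noteq> {} \<longrightarrow> g \<subseteq> W"
  have fin: "finite N" using N finite_V by (meson finite_subset)
  have LN: "\<And>v. v \<in> N \<Longrightarrow> card (L v) = 2" and fN: "\<And>v. v \<in> N \<Longrightarrow> f v \<in> L v"
    using f N L by (auto simp: list_coloring_def)
  obtain f' where f': "\<And>v. v \<notin> N \<Longrightarrow> f' v = f v" "\<And>v. v \<in> N \<Longrightarrow> f' v \<in> L v"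
    "\<And>a. card {v \<in> N. f' v = a} \<le> m"
    using cap_color_classes[where f = f and L = L, OF fin small LN fN] by blast
  have "\<not> monochromatic f' g" if g: "g \<in> E" "g \<inter> N \<noteq> {}" for g
  proof
    assume "monochromatic f' g"
    then obtain c where "\<forall>v\<in>g. f' v = c" by (auto simp: monochromatic_def)
    then have "g \<inter> N \<subseteq> {v \<in> N. f' v = c}" by auto
    then have "card (g \<inter> N) \<le> card {v \<in> N. f' v = c}" using fin by (intro card_mono) auto
    then show False using large[OF g] inside g f'(3)[of c] by fastforce
  qed
  then show "\<exists>f'. (\<forall>v. v \<notin> N \<longrightarrow> f' v = f v) \<and> (\<forall>v\<in>N. f' v \<in> L v) \<and>
      (\<forall>g\<in>E. g \<inter> N \<noteq> {} \<longrightarrow> \<not> monochromatic f' g)"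
    using f' by blast
qed

text \<open>The invariant of the rounds; propagating it from each \<open>T\<close> to
  \<open>Suc T\<close> contradicts \<open>explored_steps_bounded\<close>.\<close>

definition open_state :: "nat \<Rightarrow> nat \<Rightarrow> 'a set \<Rightarrow> 'a set \<Rightarrow> bool" where
  "open_state T X W P \<longleftrightarrow> explored E V T X W P \<and> closed_under E W \<and>
     (\<exists>w\<in>P. \<exists>e\<in>E. e \<inter> W = {w})"

text \<open>Here all of \<open>W\<close> counts as new: \<open>sparse\<close> with one tree step
  gives \<open>card W \<le> 2 * r\<close>, and edges inside \<open>W\<close> have
  \<open>r + 1\<close> vertices, so \<open>m = r\<close> works.\<close>

lemma open_state_start:
  assumes "explored E V 1 X W W" "closed_under E W" "e \<in> E" "e \<subseteq> W"
  shows "open_state 1 X W W"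
proof -
  have "\<exists>w\<in>W. \<exists>g\<in>E. g \<inter> W = {w}"
  proof (rule tree_edge_at_small[where m = r])
    show "e \<inter> W \<noteq> {}" using assms edge_card[of e] by (auto simp: Int_absorb2)
    show "card W \<le> 2 * r" using sparse[OF assms(1)] by simp
    show "r < card (g \<inter> W)" if "g \<in> E" "g \<inter> W \<noteq> {}" "g \<subseteq> W" for g
      using that edge_card[of g] by (simp add: Int_absorb2)
  qed (use assms explored_subset[OF assms(1)] in auto)
  then show ?thesis using assms by (simp add: open_state_def)
qed

text \<open>The edge \<open>g\<close> is not contained in the closed set \<open>W\<close>, so at
  most one of its \<open>r + 1\<close> vertices lies there.\<close>

lemma card_new_part:
  assumes "closed_under E W" "finite W" "g \<in> E" "g \<inter> (W' - W) \<noteq> {}" "g \<subseteq> W'"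
  shows "r - 1 < card (g \<inter> (W' - W))"
proof -
  have "card (g \<inter> W) \<le> 1" using assms by (auto simp: closed_under_def)
  moreover have "card (g - (g \<inter> W)) = card g - card (g \<inter> W)"
    using finite_edge assms by (intro card_Diff_subset) auto
  moreover have "g \<inter> (W' - W) = g - (g \<inter> W)" using assms by auto
  ultimately have "card (g \<inter> W) \<le> 1" "card (g \<inter> (W' - W)) = card g - card (g \<inter> W)" by simp_all
  then show ?thesis using edge_card[OF assms(3)] r_ge by linarith
qed

lemma open_state_extend:
  assumes old: "explored E V T X W P" "closed_under E W"
    and new: "explored E V (Suc T) X' W' P'" "closed_under E W'" "W \<subseteq> W'" "W' - W \<subseteq> P'"
    and e: "e \<in> E" "e \<inter> (W' - W) \<noteq> {}" and small: "card W' + 2 \<le> card W + 2 * r"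
  shows "open_state (Suc T) X' W' P'"
proof -
  have fin: "finite W" using explored_finite old by blast
  have "\<exists>w\<in>W' - W. \<exists>g\<in>E. g \<inter> W' = {w}"
  proof (rule tree_edge_at_small[where m = "r - 1"])
    have "card (W' - W) = card W' - card W"
      using new fin by (intro card_Diff_subset) auto
    then show "card (W' - W) \<le> 2 * (r - 1)" using small by linarith
    show "r - 1 < card (g \<inter> (W' - W))" if "g \<in> E" "g \<inter> (W' - W) \<noteq> {}" "g \<subseteq> W'" for g
      using card_new_part[OF old(2) fin that] .
  qed (use new e explored_subset[OF new(1)] in auto)
  then show ?thesis using new by (auto simp: open_state_def)
qed

lemma tree_step_facts:
  assumes "explored E V T X W P" "w \<in> P" "e \<in> E" "e \<inter> W = {w}"
  shows "explored E V (Suc T) X (W \<union> e) e" "card (W \<union> e) = card W + r" "e - W \<noteq> {}"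
proof -
  show "explored E V (Suc T) X (W \<union> e) e" using explored.tree[OF assms] .
  show *: "card (W \<union> e) = card W + r"
    using card_tree_step[OF explored_finite(1)[OF assms(1)] assms(3,4)] .
  show "e - W \<noteq> {}"
  proof
    assume "e - W = {}"
    then have "W \<union> e = W" by auto
    then show False using * r_ge by simp
  qed
qed

text \<open>The second assumption says \<open>k \<ge> 1\<close>. Since \<open>sparse\<close> caps
  \<open>card W'\<close> at \<open>r * T + 2 * r\<close>, the round adds at most
  \<open>2 * r - 2\<close> vertices; neither kind of step lowers \<open>k\<close>.\<close>

lemma open_state_step:
  assumes "open_state T X W P" "r * T + 2 \<le> card W"
  shows "\<exists>X' W' P'. open_state (Suc T) X' W' P' \<and> r * Suc T + 2 \<le> card W'"
proof -
  obtain w e where old: "explored E V T X W P" "closed_under E W"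
    and we: "w \<in> P" "e \<in> E" "e \<inter> W = {w}"
    using assms(1) by (auto simp: open_state_def)
  note st = tree_step_facts[OF old(1) we]
  obtain X' W' where new: "explored E V (Suc T) X' W' (e \<union> (W' - (W \<union> e)))"
    "W \<union> e \<subseteq> W'" "closed_under E W'"
    using saturate[OF st(1)] by blast
  have "open_state (Suc T) X' W' (e \<union> (W' - (W \<union> e)))"
  proof (rule open_state_extend[OF old new(1,3)])
    show "card W' + 2 \<le> card W + 2 * r" using sparse[OF new(1)] assms(2) by simp
  qed (use new st we in auto)
  moreover have "card (W \<union> e) \<le> card W'"
    using new explored_finite by (meson card_mono)
  ultimately show ?thesis using st(2) assms(2) by fastforce
qed

lemma explored_steps_bounded: "explored E V T X W P \<Longrightarrow> T < card V"
proof -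
  assume ex: "explored E V T X W P"
  have "card W \<le> card V" using explored_subset[OF ex] finite_V by (intro card_mono) auto
  moreover have "T \<le> r * T" using r_ge by simp
  ultimately show ?thesis using explored_card_ge[OF ex] by linarith
qed

text \<open>Two edges sharing two vertices would start an exploration with \<open>k \<ge> 1\<close>,
  which \<open>open_state_step\<close> would continue forever.\<close>

lemma linear:
  assumes "e \<in> E" "g \<in> E" "e \<noteq> g"
  shows "card (e \<inter> g) \<le> 1"
proof (rule ccontr)
  assume "\<not> ?thesis"
  then obtain u v where uv: "u \<in> g \<inter> e" "v \<in> g \<inter> e" "u \<noteq> v"
    using finite_edge[OF assms(1)] by (metis Int_commute One_nat_def card_le_Suc0_iff_eq finite_Int)
  have "\<not> g \<subseteq> e"
    using assms edge_card finite_edge by (metis card_subset_eq)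
  have "u \<in> V" using edge_subset assms uv by auto
  have "explored E V (Suc 0) 0 ({u} \<union> e) e"
    using assms uv by (intro explored.tree[OF explored.start[OF \<open>u \<in> V\<close>]]) auto
  moreover have "{u} \<union> e = e" using uv by auto
  ultimately have e: "explored E V 1 0 e e" by simp
  have "explored E V 1 1 (e \<union> g) (e \<union> g)"
    using explored.excess[OF e assms(2) \<open>\<not> g \<subseteq> e\<close> uv] by simp
  from saturate[OF this] obtain X W where
    W: "explored E V 1 X W (e \<union> g \<union> (W - (e \<union> g)))" "e \<union> g \<subseteq> W" "closed_under E W"
    by blast
  then have W1: "explored E V 1 X W W" by (simp add: Un_absorb1)
  have o: "open_state 1 X W W" using open_state_start[OF W1] W assms by blast
  have "card e < card (e \<union> g)" using card_excess_step \<open>\<not> g \<subseteq> e\<close> assms finite_edge by blast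
  also have "\<dots> \<le> card W" using W explored_finite by (meson card_mono)
  finally have c: "r * 1 + 2 \<le> card W" using edge_card[OF assms(1)] by simp
  have "\<exists>X W P. open_state (Suc n) X W P \<and> r * Suc n + 2 \<le> card W" for n
  proof (induction n)
    case 0
    show ?case using o c by auto
  next
    case (Suc n)
    then show ?case using open_state_step by blast
  qed
  from this[of "card V"] show False using explored_steps_bounded
    by (meson Suc_lessD less_irrefl open_state_def)
qed


lemma linear_unique:
  assumes "e \<in> E" "g \<in> E" "e \<noteq> g" "u \<in> e" "u \<in> g" "v \<in> e" "v \<in> g"
  shows "u = v"
  using linear[OF assms(1-3)] card_le_Suc0_iff_eq[of "e \<inter> g"] finite_edge[OF assms(1)] assms
  by auto

text \<open>An edge \<open>g\<close> joins \<open>W\<close> to a new vertex of \<open>e\<close>. The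
  round then adds \<open>2 * r - 1\<close> vertices, one too many for
  \<open>open_state_extend\<close>, so the new part is recoloured explicitly.\<close>

lemma open_state_cycle:
  assumes old: "explored E V T X W P" "closed_under E W"
    and we: "w \<in> P" "e \<in> E" "e \<inter> W = {w}"
    and not_closed: "\<not> closed_under E (W \<union> e)"
  shows "\<exists>X' W' P'. open_state (Suc T) X' W' P'"
proof -
  note st = tree_step_facts[OF old(1) we]
  have fin: "finite W" using explored_finite old by blast
  have closed1: "p = q" if "h \<in> E" "\<not> h \<subseteq> W" "p \<in> h" "q \<in> h" "p \<in> W" "q \<in> W" for h p q
    using old(2) that finite_edge[OF that(1)] card_le_Suc0_iff_eq[of "h \<inter> W"]
    by (auto simp: closed_under_def)
  have w: "w \<in> e" "w \<in> W" using we by auto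
  obtain g where g: "g \<in> E" "\<not> g \<subseteq> W \<union> e"
    and "\<exists>u v. u \<in> g \<inter> (W \<union> e) \<and> v \<in> g \<inter> (W \<union> e) \<and> u \<noteq> v"
    using not_closed by (rule not_closedE) blast
  moreover have "g \<noteq> e" "\<not> g \<subseteq> W" using g by auto
  note ge = linear_unique[OF g(1) we(2) this(1)] closed1[OF g(1) this(2)] and this
  ultimately obtain u x where ux: "u \<in> g" "u \<in> W" "x \<in> g" "x \<in> e" "u \<noteq> x" by blast
  have xW: "x \<notin> W" using ge(2)[of u x] ux by auto
  have ue: "u \<notin> e" using ge(1)[of u x] ux by auto
  define W' where "W' = W \<union> e \<union> g"
  have new: "explored E V (Suc T) (Suc X) W' (e \<union> (g - (W \<union> e)))"
    unfolding W'_def using ux by (intro explored.excess[OF st(1) g, of u x]) auto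
  have gi: "g \<inter> (W \<union> e) = {u, x}" using ux ge(1,2) by blast
  have "card (g \<inter> (W \<union> e)) = 2" unfolding gi using ux by simp
  then have card_W': "card W' + 1 = card W + 2 * r"
    using card_Un_Int[of "W \<union> e" g] fin finite_edge we g st(2) edge_card[OF g(1)]
    by (simp add: W'_def Int_commute)
  \<comment> \<open>A further excess step would give at least \<open>r * T + 1 + 2 * r\<close>
    vertices after \<open>Suc T\<close> tree steps, against \<open>sparse\<close>.\<close>
  have closed': "closed_under E W'"
  proof (rule ccontr)
    assume "\<not> ?thesis"
    then obtain h p q where h: "h \<in> E" "\<not> h \<subseteq> W'" "p \<in> h \<inter> W'" "q \<in> h \<inter> W'" "p \<noteq> q"
      by (rule not_closedE)
    show False
      using sparse[OF explored.excess[OF new h]] explored_card_ge[OF old(1)] card_W'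
        card_excess_step[OF explored_finite(1)[OF new] h(2,1)] by simp
  qed
  have few: False if "h \<in> E" "h \<subseteq> A \<union> B" "card (h \<inter> A) \<le> 1" "card (h \<inter> B) \<le> 1" for h A B
  proof -
    have "h = (h \<inter> A) \<union> (h \<inter> B)" using that by auto
    then have "card h \<le> card (h \<inter> A) + card (h \<inter> B)" by (metis card_Un_le)
    then show False using edge_card[OF that(1)] r_ge that by linarith
  qed
  have third: "\<exists>c\<in>h. c \<noteq> p \<and> c \<noteq> q" if "h \<in> E" for h p q
  proof (rule ccontr)
    assume "\<not> ?thesis"
    then have "h \<subseteq> {p, q}" by auto
    then have "card h \<le> card {p, q}" by (intro card_mono) auto
    also have "\<dots> \<le> 2" by (simp add: card_insert_if)
    finally show False using edge_card[OF that] r_ge by linarith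
  qed
  \<comment> \<open>The new vertices \<open>a\<close> and \<open>b\<close> belong to only one of
    \<open>e\<close> and \<open>g\<close> each, whereas \<open>x\<close> belongs to both.\<close>
  obtain a where a: "a \<in> e" "a \<noteq> w" "a \<noteq> x" using third we by blast
  obtain b where b: "b \<in> g" "b \<noteq> u" "b \<noteq> x" using third g by blast
  have a': "a \<notin> W" "a \<notin> g" using a we(3) ge(1)[of a x] ux by auto
  have b': "b \<notin> W" "b \<notin> e" using b ge(2)[of b u] ge(1)[of b x] ux by auto
  have inV: "W' \<subseteq> V" using explored_subset[OF new] by blast
  have "\<exists>v\<in>W' - W. \<exists>h\<in>E. h \<inter> W' = {v}"
  proof (rule tree_edge_at[OF _ inV closed' we(2)])
    show "e \<inter> (W' - W) \<noteq> {}" using a a' by (auto simp: W'_def)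
  next
    fix f assume f: "list_coloring L V {g \<in> E. g \<inter> (W' - W) = {}} f"
      and inside: "\<forall>g\<in>E. g \<inter> (W' - W) \<noteq> {} \<longrightarrow> g \<subseteq> W'"
    \<comment> \<open>Linearity leaves room for such an \<open>h\<close> only if \<open>r = 2\<close>, and then for at most one.\<close>
    have other: "a \<in> h \<and> b \<in> h \<and> h \<inter> W \<noteq> {}"
      if h: "h \<in> E" "h \<inter> (W' - W) \<noteq> {}" "h \<noteq> e" "h \<noteq> g" for h
    proof -
      have hsub: "h \<subseteq> W \<union> e \<union> g" using inside h(1,2) by (simp add: W'_def)
      have hW: "card (h \<inter> W) \<le> 1" using old(2) h by (auto simp: closed_under_def)
      have he: "card (h \<inter> e) \<le> 1" and hg: "card (h \<inter> g) \<le> 1"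
        using linear h we g by auto
      have "h = (h \<inter> W) \<union> (h \<inter> e) \<union> (h \<inter> g)" using hsub by auto
      then have "card h \<le> card (h \<inter> W) + card (h \<inter> e) + card (h \<inter> g)"
        by (metis card_Un_le add_le_mono1 order_trans)
      then have r: "r = 2" using hW he hg edge_card[OF h(1)] r_ge by linarith
      have full: "k = {p, q, c}" if "k \<in> E" "p \<in> k" "q \<in> k" "c \<in> k" "p \<noteq> q" "c \<noteq> p" "c \<noteq> q" for k p q c
        using that edge_card[OF that(1)] r finite_edge[OF that(1)]
        by (intro card_subset_eq[symmetric]) auto
      have e: "e = {w, x, a}" using full[OF we(2)] w ux a xW by blast
      have g: "g = {u, x, b}" using full[OF g(1)] ux b by blast
      \<comment> \<open>No two of \<open>W\<close>, \<open>e\<close>, \<open>g\<close> cover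
        \<open>h\<close>. As \<open>w\<close> and \<open>u\<close> lie in \<open>W\<close> and
        \<open>x\<close> lies in both edges, \<open>h\<close> must take \<open>a\<close> from
        \<open>e\<close> and \<open>b\<close> from \<open>g\<close>.\<close>
      have "h \<inter> W \<noteq> {}" using few[OF h(1) _ he hg] hsub by blast
      moreover have "a \<in> h" using few[OF h(1) _ hW hg] hsub w ux unfolding e by blast
      moreover have "b \<in> h" using few[OF h(1) _ hW he] hsub w ux unfolding g by blast
      ultimately show ?thesis by blast
    qed
    \<comment> \<open>One colour \<open>d\<close> serves all third edges: two of them would share
      \<open>a\<close> and \<open>b\<close>, so there is at most one.\<close>
    have "\<exists>d. \<forall>h\<in>E. h \<inter> (W' - W) \<noteq> {} \<and> h \<noteq> e \<and> h \<noteq> g \<longrightarrow> (\<exists>y\<in>h \<inter> W. f y = d)"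
    proof (cases "\<exists>h\<in>E. h \<inter> (W' - W) \<noteq> {} \<and> h \<noteq> e \<and> h \<noteq> g")
      case True
      then obtain h where h: "h \<in> E" "h \<inter> (W' - W) \<noteq> {}" "h \<noteq> e" "h \<noteq> g" by blast
      obtain y where y: "y \<in> h \<inter> W" using other[OF h] by blast
      have "k = h" if "k \<in> E" "k \<inter> (W' - W) \<noteq> {}" "k \<noteq> e" "k \<noteq> g" for k
        using linear_unique[OF that(1) h(1), of a b] other[OF that] other[OF h] a' b by blast
      then show ?thesis using y by blast
    qed blast
    then obtain d where d: "\<And>h. h \<in> E \<Longrightarrow> h \<inter> (W' - W) \<noteq> {} \<Longrightarrow> h \<noteq> e \<Longrightarrow> h \<noteq> g \<Longrightarrow>
      \<exists>y\<in>h \<inter> W. f y = d" by blast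
    have xab: "x \<in> V" "a \<in> V" "b \<in> V" using edge_subset we g ux a b by auto
    obtain c1 where c1: "c1 \<in> L x" "c1 \<noteq> f w" using other_element L xab by metis
    obtain c2 where c2: "c2 \<in> L b" "c2 \<noteq> f u" using other_element L xab by metis
    obtain c3 where c3: "c3 \<in> L a" "c3 \<noteq> d" using other_element L xab by metis
    \<comment> \<open>Each of the at most three edges gets its own vertex to break it: \<open>x\<close> for \<open>e\<close>, \<open>b\<close> for \<open>g\<close>,
      and \<open>a\<close> for the possible third edge.\<close>
    define f' where "f' = f(x := c1, b := c2, a := c3)"
    have f'W: "f' v = f v" if "v \<in> W" for v using that xW a' b' by (auto simp: f'_def)
    have vals: "f' x = c1" "f' b = c2" "f' a = c3"
      using a b a' by (auto simp: f'_def)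
    have eq: "f' p = f' q" if "monochromatic f' h" "p \<in> h" "q \<in> h" for h p q
      using that by (auto simp: monochromatic_def)
    have "\<not> monochromatic f' h" if h: "h \<in> E" "h \<inter> (W' - W) \<noteq> {}" for h
    proof
      assume m: "monochromatic f' h"
      consider "h = e" | "h = g" | "h \<noteq> e" "h \<noteq> g" by blast
      then show False
      proof cases
        case 1
        then show False using eq[OF m, of x w] ux w vals f'W c1 by simp
      next
        case 2
        then show False using eq[OF m, of b u] ux b vals f'W c2 by simp
      next
        case 3
        then obtain y where "y \<in> h \<inter> W" "f y = d" using d h by blast
        then show False using eq[OF m, of a y] other[OF h 3] vals f'W c3 by simp
      qed
    qed
    moreover have "\<forall>v. v \<notin> W' - W \<longrightarrow> f' v = f v"
      using ux a b xW a' b' by (auto simp: f'_def W'_def)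
    moreover have "\<forall>v\<in>W' - W. f' v \<in> L v"
      using f inV c1 c2 c3 by (auto simp: f'_def list_coloring_def)
    ultimately show "\<exists>f'. (\<forall>v. v \<notin> W' - W \<longrightarrow> f' v = f v) \<and> (\<forall>v\<in>W' - W. f' v \<in> L v) \<and>
        (\<forall>g\<in>E. g \<inter> (W' - W) \<noteq> {} \<longrightarrow> \<not> monochromatic f' g)" by blast
  qed auto
  moreover have "W' - W \<subseteq> e \<union> (g - (W \<union> e))" by (auto simp: W'_def)
  ultimately have "open_state (Suc T) (Suc X) W' (e \<union> (g - (W \<union> e)))"
    using new closed' unfolding open_state_def by blast
  then show ?thesis by blast
qed

text \<open>If the tree step leaves a closed set, it has added only \<open>r \<le> 2 * r - 2\<close>
  vertices; otherwise a cycle closes.\<close>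

lemma open_state_step_linear:
  assumes "open_state T X W P"
  shows "\<exists>X' W' P'. open_state (Suc T) X' W' P'"
proof -
  obtain w e where old: "explored E V T X W P" "closed_under E W"
    and we: "w \<in> P" "e \<in> E" "e \<inter> W = {w}"
    using assms by (auto simp: open_state_def)
  note st = tree_step_facts[OF old(1) we]
  show ?thesis
  proof (cases "closed_under E (W \<union> e)")
    case True
    have "open_state (Suc T) X (W \<union> e) e"
      using open_state_extend[OF old st(1) True] we st(2,3) r_ge by auto
    then show ?thesis by blast
  qed (use open_state_cycle[OF old we] in blast)
qed

text \<open>By linearity a single edge is already closed, so the rounds can start from it, and they
  never end.\<close>

lemma no_critical_edges: False
proof -
  have "E \<noteq> {}"
  proof
    assume "E = {}"
    moreover have "\<exists>c. c \<in> L v" if "v \<in> V" for v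
      using L[OF that] by (metis card.empty all_not_in_conv zero_neq_numeral)
    ultimately have "list_coloring L V E (\<lambda>v. SOME c. c \<in> L v)"
      by (simp add: list_coloring_def some_in_eq ex_in_conv)
    then show False using not_colorable by blast
  qed
  then obtain e where e: "e \<in> E" by blast
  then obtain v where v: "v \<in> e" using edge_card[of e] by fastforce
  have "explored E V (Suc 0) 0 ({v} \<union> e) e"
    using v e edge_subset by (intro explored.tree[OF explored.start]) auto
  moreover have "{v} \<union> e = e" using v by auto
  ultimately have x: "explored E V 1 0 e e" by simp
  have "closed_under E e"
    using linear[OF _ e] by (auto simp: closed_under_def)
  then have o: "open_state 1 0 e e" using open_state_start[OF x] e by blast
  have "\<exists>X W P. open_state (Suc n) X W P" for n
  proof (induction n)
    case 0
    show ?case using o by auto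
  next
    case (Suc n)
    then show ?case using open_state_step_linear by blast
  qed
  from this[of "card V"] show False using explored_steps_bounded
    by (meson Suc_lessD less_irrefl open_state_def)
qed

end

section \<open>From uncolourable edge sets to dense explorations\<close>

context uniform_edges
begin

lemma uniform_edges_subset: "E' \<subseteq> E \<Longrightarrow> uniform_edges V E' r"
  by unfold_locales (use finite_V edge_subset edge_card r_ge in auto)

text \<open>By \<open>no_critical_edges\<close>, a minimal uncolourable \<open>F\<close> must
  violate \<open>sparse\<close>.\<close>

lemma uncolorable_dense:
  assumes L: "\<And>v. v \<in> V \<Longrightarrow> card (L v) = 2" and unc: "\<nexists>f. list_coloring L V E f"
  shows "\<exists>T X W P. explored E V T X W P \<and> X \<le> r \<and> r * Suc T < card W"
proof -
  have "finite {F. F \<subseteq> E \<and> (\<nexists>f. list_coloring L V F f)}" using finite_E by simp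
  moreover have "E \<in> {F. F \<subseteq> E \<and> (\<nexists>f. list_coloring L V F f)}" using unc by simp
  ultimately obtain F where F: "F \<subseteq> E" "\<nexists>f. list_coloring L V F f"
    and min: "\<And>F'. F' \<subset> F \<Longrightarrow> \<exists>f. list_coloring L V F' f"
    using finite_has_minimal2 by (smt (verit) mem_Collect_eq psubset_eq subset_trans)
  interpret F: uniform_edges V F r using uniform_edges_subset F by blast
  have "\<exists>T X W P. explored F V T X W P \<and> r * Suc T < card W"
  proof (rule ccontr)
    assume "\<not> ?thesis"
    then interpret critical_edges V F r L
      by unfold_locales (use L F min in \<open>auto simp: not_less\<close>)
    show False by (rule no_critical_edges)
  qed
  then obtain T X W P where "explored F V T X W P" "r * Suc T < card W" by blast
  \<comment> \<open>Go back to the step at which \<open>k\<close> first reaches \<open>r\<close>.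
    Tree steps keep \<open>k\<close>, so it is an excess step, and before it
    \<open>X \<le> k < r\<close>.\<close>
  then have "\<exists>T X W P. explored F V T X W P \<and> X \<le> r \<and> r * Suc T < card W"
  proof (induction rule: explored.induct)
    case (start v)
    then show ?case by (intro exI[of _ 0]) (use r_ge in auto)
  next
    case (tree T X W P w e)
    then show ?case using F.card_tree_step[of W e w] F.explored_finite[OF tree(1)] by simp
  next
    case (excess T X W P e u v)
    show ?case
    proof (cases "r * Suc T < card W")
      case False
      then have "Suc X \<le> r" using F.explored_card_ge[OF excess(1)] by simp
      then show ?thesis using explored.excess[OF excess(1-6)] excess.prems by blast
    qed (use excess.IH in blast)
  qed
  then show ?thesis using explored_mono F(1) by blast
qed

definition states :: "nat \<Rightarrow> nat \<Rightarrow> ('a set \<times> 'a set) set" where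
  "states T X = {(W, P). explored E V T X W P}"

lemma finite_states: "finite (states T X)"
proof -
  have "states T X \<subseteq> Pow V \<times> Pow V"
    using explored_subset by (fastforce simp: states_def)
  then show ?thesis using finite_V by (meson finite_Pow_iff finite_SigmaI finite_subset)
qed

end

section \<open>Counting explored sets\<close>

lemma card_UN_bounded:
  assumes "finite I" "\<And>i. i \<in> I \<Longrightarrow> card (F i) \<le> k"
  shows "card (\<Union>i\<in>I. F i) \<le> card I * k"
  using card_UN_le[OF assms(1), of F] sum_bounded_above[of I "\<lambda>i. card (F i)" k] assms(2)
  by fastforce

locale bounded_codegree = uniform_edges +
  fixes D :: nat
  assumes codegree: "u \<in> V \<Longrightarrow> v \<in> V \<Longrightarrow> u \<noteq> v \<Longrightarrow> card {e \<in> E. u \<in> e \<and> v \<in> e} \<le> D"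
begin

lemma degree_le:
  assumes "u \<in> V"
  shows "card {e \<in> E. u \<in> e} \<le> card V * D"
proof -
  have "{e \<in> E. u \<in> e} \<subseteq> (\<Union>v\<in>V - {u}. {e \<in> E. u \<in> e \<and> v \<in> e})"
  proof
    fix e assume e: "e \<in> {e \<in> E. u \<in> e}"
    have "\<not> e \<subseteq> {u}"
    proof
      assume "e \<subseteq> {u}"
      then have "card e \<le> card {u}" by (intro card_mono) auto
      then show False using edge_card[of e] e r_ge by simp
    qed
    then show "e \<in> (\<Union>v\<in>V - {u}. {e \<in> E. u \<in> e \<and> v \<in> e})" using e edge_subset by blast
  qed
  then have "card {e \<in> E. u \<in> e} \<le> card (\<Union>v\<in>V - {u}. {e \<in> E. u \<in> e \<and> v \<in> e})"
    using finite_E finite_V by (intro card_mono) auto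
  also have "\<dots> \<le> card (V - {u}) * D"
    using codegree assms finite_V by (intro card_UN_bounded) auto
  also have "\<dots> \<le> card V * D"
    using finite_V by (intro mult_right_mono card_mono) auto
  finally show ?thesis .
qed

definition tree_successors :: "('a set \<times> 'a set) set \<Rightarrow> ('a set \<times> 'a set) set" where
  "tree_successors S =
     (\<Union>(W, P)\<in>S. \<Union>w\<in>P. (\<lambda>e. (W \<union> e, e)) ` {e \<in> E. w \<in> e})"

definition excess_successors :: "('a set \<times> 'a set) set \<Rightarrow> ('a set \<times> 'a set) set" where
  "excess_successors S =
     (\<Union>(W, P)\<in>S. \<Union>(u, v)\<in>{(u, v). u \<in> W \<and> v \<in> W \<and> u \<noteq> v}.
        (\<lambda>e. (W \<union> e, P \<union> (e - W))) ` {e \<in> E. u \<in> e \<and> v \<in> e})"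

lemma card_tree_successors:
  assumes "X \<le> r"
  shows "card (tree_successors (states T X)) \<le> card (states T X) * (Suc r * Suc r * (card V * D))"
  unfolding tree_successors_def
proof (rule card_UN_bounded[OF finite_states], clarsimp simp only: split: prod.splits)
  fix W P assume "(W, P) \<in> states T X"
  then have ex: "explored E V T X W P" by (simp add: states_def)
  have PV: "P \<subseteq> V" using explored_subset[OF ex] by blast
  have "card (\<Union>w\<in>P. (\<lambda>e. (W \<union> e, e)) ` {e \<in> E. w \<in> e}) \<le> card P * (card V * D)"
  proof (rule card_UN_bounded[OF explored_finite(2)[OF ex]])
    fix w assume "w \<in> P"
    have "card ((\<lambda>e. (W \<union> e, e)) ` {e \<in> E. w \<in> e}) \<le> card {e \<in> E. w \<in> e}"
      using finite_E by (intro card_image_le) auto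
    also have "\<dots> \<le> card V * D" using degree_le PV \<open>w \<in> P\<close> by blast
    finally show "card ((\<lambda>e. (W \<union> e, e)) ` {e \<in> E. w \<in> e}) \<le> card V * D" .
  qed
  also have "card P \<le> Suc r * Suc r"
    using explored_front_card_le[OF ex] assms by (meson Suc_le_mono le_trans mult_le_mono2)
  finally show "card (\<Union>w\<in>P. (\<lambda>e. (W \<union> e, e)) ` {e \<in> E. w \<in> e}) \<le> Suc r * Suc r * (card V * D)"
    by simp
qed

text \<open>Choose two vertices of \<open>W\<close>, then one of at most \<open>D\<close> edges
  through both: there is no factor \<open>card V\<close>, only a polynomial in
  \<open>M\<close>.\<close>

lemma card_excess_successors:
  assumes "X \<le> r" "T \<le> M"
  shows "card (excess_successors (states T X)) \<le> card (states T X) * ((1 + Suc r * (M + r))\<^sup>2 * D)"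
  unfolding excess_successors_def
proof (rule card_UN_bounded[OF finite_states], clarsimp simp only: split: prod.splits)
  fix W P assume "(W, P) \<in> states T X"
  then have ex: "explored E V T X W P" by (simp add: states_def)
  let ?I = "{(u, v). u \<in> W \<and> v \<in> W \<and> u \<noteq> v}"
  let ?F = "\<lambda>u v. (\<lambda>e. (W \<union> e, P \<union> (e - W))) ` {e \<in> E. u \<in> e \<and> v \<in> e}"
  have WV: "W \<subseteq> V" and fin: "finite W" using explored_subset[OF ex] explored_finite[OF ex] by auto
  have I: "?I \<subseteq> W \<times> W" by auto
  have finI: "finite ?I" using I fin by (meson finite_SigmaI finite_subset)
  have "card (\<Union>(u, v)\<in>?I. ?F u v) \<le> card ?I * D"
  proof (rule card_UN_bounded[OF finI], clarify)
    fix u v assume uv: "u \<in> W" "v \<in> W" "u \<noteq> v"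
    have "card (?F u v) \<le> card {e \<in> E. u \<in> e \<and> v \<in> e}"
      using finite_E by (intro card_image_le) auto
    also have "\<dots> \<le> D" using codegree WV uv by blast
    finally show "card (?F u v) \<le> D" .
  qed
  also have "card ?I \<le> (card W)\<^sup>2"
    using card_mono[OF _ I] fin by (simp add: power2_eq_square)
  also have "card W \<le> 1 + Suc r * (M + r)"
    using explored_card_le[OF ex] assms
    by (meson add_le_mono add_left_mono le_trans mult_le_mono2)
  finally show "card (\<Union>(u, v)\<in>?I. ?F u v) \<le> (1 + Suc r * (M + r))\<^sup>2 * D"
    by (simp add: power_mono)
qed

lemma states_subset:
  "states 0 0 \<subseteq> (\<lambda>v. ({v}, {v})) ` V"
  "states (Suc T) 0 \<subseteq> tree_successors (states T 0)"
  "states 0 (Suc X) \<subseteq> excess_successors (states 0 X)"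
  "states (Suc T) (Suc X) \<subseteq> tree_successors (states T (Suc X)) \<union> excess_successors (states (Suc T) X)"
proof -
  have *: "(case T of 0 \<Rightarrow> False | Suc T' \<Rightarrow> (W, P) \<in> tree_successors (states T' X)) \<or>
      (case X of 0 \<Rightarrow> False | Suc X' \<Rightarrow> (W, P) \<in> excess_successors (states T X')) \<or>
      T = 0 \<and> X = 0 \<and> (W, P) \<in> (\<lambda>v. ({v}, {v})) ` V"
    if "(W, P) \<in> states T X" for T X W P
  proof -
    have "explored E V T X W P" using that by (simp add: states_def)
    then show ?thesis
    proof (cases rule: explored.cases)
      case (tree T' W' P' w)
      then have "(W, P) \<in> tree_successors (states T' X)"
        unfolding tree_successors_def states_def
        by (intro UN_I[of "(W', P')"]) (auto intro!: bexI[of _ w] imageI)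
      then show ?thesis using tree by simp
    next
      case (excess X' W' P' e u v)
      then have "(W, P) \<in> (\<lambda>e. (W' \<union> e, P' \<union> (e - W'))) ` {e \<in> E. u \<in> e \<and> v \<in> e}"
        by (intro image_eqI[of _ _ e]) auto
      moreover have "(W', P') \<in> states T X'" "(u, v) \<in> {(u, v). u \<in> W' \<and> v \<in> W' \<and> u \<noteq> v}"
        using excess by (auto simp: states_def)
      ultimately have "(W, P) \<in> excess_successors (states T X')"
        unfolding excess_successors_def by blast
      then show ?thesis using excess by simp
    qed auto
  qed
  show "states 0 0 \<subseteq> (\<lambda>v. ({v}, {v})) ` V"
    by (rule subrelI) (use *[of _ _ 0 0] in simp)
  show "states (Suc T) 0 \<subseteq> tree_successors (states T 0)"
    by (rule subrelI) (use *[of _ _ "Suc T" 0] in simp)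
  show "states 0 (Suc X) \<subseteq> excess_successors (states 0 X)"
    by (rule subrelI) (use *[of _ _ 0 "Suc X"] in simp)
  show "states (Suc T) (Suc X) \<subseteq>
      tree_successors (states T (Suc X)) \<union> excess_successors (states (Suc T) X)"
    by (rule subrelI) (use *[of _ _ "Suc T" "Suc X"] in simp)
qed

lemma finite_successors:
  "finite (tree_successors (states T X))" "finite (excess_successors (states T X))"
proof -
  show "finite (tree_successors (states T X))"
    unfolding tree_successors_def using finite_states finite_E explored_finite
    by (fastforce simp: states_def intro!: finite_UN_I[OF finite_states])
  show "finite (excess_successors (states T X))"
    unfolding excess_successors_def
  proof (rule finite_UN_I[OF finite_states], clarify)
    fix W P assume "(W, P) \<in> states T X"
    then have "finite W" using explored_finite by (simp add: states_def)
    then have "finite {(u, v). u \<in> W \<and> v \<in> W \<and> u \<noteq> v}"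
      by (rule_tac finite_subset[of _ "W \<times> W"]) auto
    then show "finite (\<Union>(u, v)\<in>{(u, v). u \<in> W \<and> v \<in> W \<and> u \<noteq> v}.
        (\<lambda>e. (W \<union> e, P \<union> (e - W))) ` {e \<in> E. u \<in> e \<and> v \<in> e})"
      using finite_E by auto
  qed
qed

text \<open>Splitting off the last step gives a sum of two terms, and the doubled factors make each
  at most half of the bound. \<open>M\<close> is kept apart from \<open>T\<close> so that the excess
  factor stays fixed during the induction.\<close>

lemma card_states_le:
  assumes "T \<le> M" "X \<le> r"
  shows "card (states T X) \<le>
    card V * (2 * (Suc r * Suc r * (card V * D))) ^ T * (2 * ((1 + Suc r * (M + r))\<^sup>2 * D)) ^ X"
proof -
  define a where "a = Suc r * Suc r * (card V * D)"
  define b where "b = (1 + Suc r * (M + r))\<^sup>2 * D"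
  have tree: "card (tree_successors (states T X)) \<le> card (states T X) * a" if "X \<le> r" for T X
    using card_tree_successors[OF that] by (simp only: a_def)
  have excess: "card (excess_successors (states T X)) \<le> card (states T X) * b"
    if "X \<le> r" "T \<le> M" for T X
    using card_excess_successors[OF that] by (simp only: b_def)
  have "card (states T X) \<le> card V * (2 * a) ^ T * (2 * b) ^ X"
    using assms
  proof (induction T arbitrary: X)
    case 0
    then show ?case
    proof (induction X)
      case 0
      have "card (states 0 0) \<le> card V"
        using surj_card_le[OF finite_V states_subset(1)] .
      then show ?case by simp
    next
      case (Suc X)
      have "card (states 0 (Suc X)) \<le> card (excess_successors (states 0 X))"
        using states_subset finite_successors by (intro card_mono)
      also have "\<dots> \<le> card (states 0 X) * b" using Suc.prems by (intro excess) auto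
      also have "\<dots> \<le> (card V * (2 * a) ^ 0 * (2 * b) ^ X) * b"
        using Suc by (intro mult_right_mono) auto
      finally show ?case by (simp add: mult_ac)
    qed
  next
    case (Suc T)
    note IH = Suc.IH
    show ?case using Suc.prems
    proof (induction X)
      case 0
      have "card (states (Suc T) 0) \<le> card (tree_successors (states T 0))"
        using states_subset finite_successors by (intro card_mono)
      also have "\<dots> \<le> card (states T 0) * a" by (intro tree) auto
      also have "\<dots> \<le> (card V * (2 * a) ^ T * (2 * b) ^ 0) * a"
        using IH[of 0] 0 by (intro mult_right_mono) auto
      finally show ?case by (simp add: mult_ac)
    next
      case (Suc X)
      have "card (states (Suc T) (Suc X)) \<le>
          card (tree_successors (states T (Suc X)) \<union> excess_successors (states (Suc T) X))"
        using states_subset finite_successors by (intro card_mono finite_UnI)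
      also have "\<dots> \<le> card (tree_successors (states T (Suc X))) + card (excess_successors (states (Suc T) X))"
        by (rule card_Un_le)
      also have "\<dots> \<le> card (states T (Suc X)) * a + card (states (Suc T) X) * b"
        using Suc.prems by (intro add_mono tree excess) auto
      also have "\<dots> \<le> (card V * (2 * a) ^ T * (2 * b) ^ Suc X) * a
          + (card V * (2 * a) ^ Suc T * (2 * b) ^ X) * b"
        using IH[of "Suc X"] Suc by (intro add_mono mult_right_mono) auto
      also have "\<dots> = card V * (2 * a) ^ Suc T * (2 * b) ^ Suc X"
        by (simp only: power_Suc) algebra
      finally show ?case .
    qed
  qed
  then show ?thesis by (simp only: a_def b_def)
qed

end

section \<open>The union bound\<close>

lemma prob_random_subset_superset:
  assumes "finite V" "W \<subseteq> V" "0 \<le> p" "p \<le> 1"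
  shows "measure_pmf.prob (random_subset V p) {U. W \<subseteq> U} = p ^ card W"
proof -
  let ?B = "\<lambda>v. if v \<in> W then {True} else UNIV"
  have "measure_pmf.prob (random_subset V p) {U. W \<subseteq> U} =
      measure_pmf.prob (Pi_pmf V False (\<lambda>_. bernoulli_pmf p)) (Pi V ?B)"
    unfolding random_subset_def measure_map_pmf
    by (rule arg_cong[where f = "measure_pmf.prob _"])
      (use assms(2) in \<open>auto simp: Pi_def vimage_def split: if_splits\<close>)
  also have "\<dots> = (\<Prod>v\<in>V. measure_pmf.prob (bernoulli_pmf p) (?B v))"
    using assms(1) by (rule measure_Pi_pmf_Pi)
  also have "\<dots> = (\<Prod>v\<in>V. if v \<in> W then p else 1)"
    using assms by (intro prod.cong) (auto simp: measure_pmf_single)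
  also have "\<dots> = p ^ card W"
    using assms by (simp add: prod.If_cases Int_absorb1)
  finally show ?thesis .
qed

context bounded_codegree
begin

text \<open>The exploration runs inside the hypergraph induced by \<open>U\<close>. The cap on
  \<open>T\<close> follows from \<open>T < card W\<close> and keeps the union bound a finite
  sum.\<close>

lemma not_choosable_explored:
  assumes "U \<subseteq> V" "\<not> choosable 2 (U, {e \<in> E. e \<subseteq> U})"
  shows "\<exists>T\<le>card V. \<exists>X\<le>r. \<exists>(W, P)\<in>states T X. r * Suc T < card W \<and> W \<subseteq> U"
proof -
  interpret U: uniform_edges U "{e \<in> E. e \<subseteq> U}" r
    by unfold_locales
      (use finite_V assms(1) edge_card r_ge in \<open>auto intro: finite_subset\<close>)
  obtain L :: "'a \<Rightarrow> nat set" where "\<And>v. v \<in> U \<Longrightarrow> card (L v) = 2"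
    and "\<nexists>f. list_coloring L U {e \<in> E. e \<subseteq> U} f"
    using assms(2) by (auto simp: choosable_def list_coloring_def)
  then obtain T X W P where ex: "explored {e \<in> E. e \<subseteq> U} U T X W P" "X \<le> r" "r * Suc T < card W"
    using U.uncolorable_dense by blast
  have WU: "W \<subseteq> U" using U.explored_subset[OF ex(1)] by blast
  have "card W \<le> card V" using WU assms(1) finite_V by (intro card_mono) auto
  moreover have "T \<le> r * Suc T" using r_ge by (simp add: trans_le_add2)
  ultimately have "T \<le> card V" using ex(3) by linarith
  moreover have "(W, P) \<in> states T X"
    using explored_mono[OF ex(1), of E V] assms(1) by (auto simp: states_def)
  ultimately show ?thesis using ex WU by blast
qed

lemma prob_not_choosable_le:
  fixes p :: real
  assumes "0 \<le> p" "p \<le> 1"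
  shows "measure_pmf.prob (random_subset V p) {U. \<not> choosable 2 (U, {e \<in> E. e \<subseteq> U})}
    \<le> (\<Sum>T\<le>card V. \<Sum>X\<le>r. card (states T X) * p ^ Suc (r * Suc T))"
proof -
  let ?M = "measure_pmf (random_subset V p)"
  define B where "B T X = {(W, P) \<in> states T X. r * Suc T < card W}" for T X
  have finB: "finite (B T X)" for T X
    using finite_states[of T X] by (rule finite_subset[rotated]) (auto simp: B_def)
  \<comment> \<open>Intersecting with the support ensures \<open>U \<subseteq> V\<close>.\<close>
  have "{U. \<not> choosable 2 (U, {e \<in> E. e \<subseteq> U})} \<inter> set_pmf (random_subset V p)
      \<subseteq> (\<Union>T\<in>{..card V}. \<Union>X\<in>{..r}. \<Union>(W, P)\<in>B T X. {U. W \<subseteq> U})"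
  proof
    fix U assume U: "U \<in> {U. \<not> choosable 2 (U, {e \<in> E. e \<subseteq> U})} \<inter> set_pmf (random_subset V p)"
    then have "U \<subseteq> V" by (auto simp: random_subset_def)
    then obtain T X W P where "T \<le> card V" "X \<le> r" "(W, P) \<in> B T X" "W \<subseteq> U"
      using not_choosable_explored[of U] U unfolding B_def by blast
    then show "U \<in> (\<Union>T\<in>{..card V}. \<Union>X\<in>{..r}. \<Union>(W, P)\<in>B T X. {U. W \<subseteq> U})" by blast
  qed
  then have "measure ?M {U. \<not> choosable 2 (U, {e \<in> E. e \<subseteq> U})}
      \<le> measure ?M (\<Union>T\<in>{..card V}. \<Union>X\<in>{..r}. \<Union>(W, P)\<in>B T X. {U. W \<subseteq> U})"
    by (subst measure_Int_set_pmf[symmetric]) (rule measure_pmf.finite_measure_mono, auto)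
  also have "\<dots> \<le> (\<Sum>T\<le>card V. measure ?M (\<Union>X\<in>{..r}. \<Union>(W, P)\<in>B T X. {U. W \<subseteq> U}))"
    by (rule measure_UNION_le) auto
  also have "\<dots> \<le> (\<Sum>T\<le>card V. \<Sum>X\<le>r. measure ?M (\<Union>(W, P)\<in>B T X. {U. W \<subseteq> U}))"
    by (intro sum_mono measure_UNION_le) auto
  also have "\<dots> \<le> (\<Sum>T\<le>card V. \<Sum>X\<le>r. card (states T X) * p ^ Suc (r * Suc T))"
  proof (intro sum_mono)
    fix T X
    have "measure ?M (\<Union>(W, P)\<in>B T X. {U. W \<subseteq> U})
        \<le> (\<Sum>(W, P)\<in>B T X. measure ?M {U. W \<subseteq> U})"
      using measure_UNION_le[OF finB[of T X], of "\<lambda>(W, P). {U. W \<subseteq> U}" ?M]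
      by (simp add: case_prod_unfold)
    also have "\<dots> \<le> (\<Sum>(W, P)\<in>B T X. p ^ Suc (r * Suc T))"
    proof (intro sum_mono, clarify)
      fix W P assume "(W, P) \<in> B T X"
      then have "explored E V T X W P" "Suc (r * Suc T) \<le> card W" by (auto simp: B_def states_def)
      then show "measure ?M {U. W \<subseteq> U} \<le> p ^ Suc (r * Suc T)"
        using prob_random_subset_superset[OF finite_V _ assms] explored_subset assms
        by (metis power_decreasing)
    qed
    also have "\<dots> = card (B T X) * p ^ Suc (r * Suc T)" by simp
    also have "\<dots> \<le> card (states T X) * p ^ Suc (r * Suc T)"
      using assms finite_states
      by (intro mult_right_mono) (auto simp: B_def intro!: card_mono)
    finally show "measure ?M (\<Union>(W, P)\<in>B T X. {U. W \<subseteq> U})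
        \<le> card (states T X) * p ^ Suc (r * Suc T)" .
  qed
  finally show ?thesis .
qed

text \<open>By \<open>sub\<close>, each tree step together with its \<open>p ^ r\<close> contributes
  a factor of at most 1/4; by \<open>K\<close>, the excess steps cost at most
  \<open>K * 2 ^ T\<close>. What remains is a geometric series with ratio 1/2.\<close>

lemma prob_not_choosable_le_geometric:
  fixes p K :: real
  assumes p: "0 \<le> p" "p \<le> 1" and D: "D \<ge> 1"
    and sub: "8 * (real (Suc r))\<^sup>2 * D * (card V * p ^ r) \<le> 1"
    and K: "\<And>T. real (Suc r * (2 * ((1 + Suc r * (T + r))\<^sup>2 * D)) ^ r) \<le> K * 2 ^ T"
  shows "measure_pmf.prob (random_subset V p) {U. \<not> choosable 2 (U, {e \<in> E. e \<subseteq> U})}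
    \<le> 2 * K * (card V * p ^ Suc r)"
proof -
  let ?a = "Suc r * Suc r * (card V * D)"
  let ?b = "\<lambda>T. (1 + Suc r * (T + r))\<^sup>2 * D"
  have b: "1 \<le> 2 * ?b T" for T using D by simp
  have "K \<ge> 0"
    using order_trans[OF of_nat_0_le_iff K[of 0]] by simp
  have "(\<Sum>X\<le>r. card (states T X) * p ^ Suc (r * Suc T)) \<le> K * (card V * p ^ Suc r) * (1/2) ^ T" for T
  proof -
    have pow: "p ^ Suc (r * Suc T) = p ^ Suc r * (p ^ r) ^ T"
      by (simp add: power_add power_mult)
    have "(\<Sum>X\<le>r. card (states T X) * p ^ Suc (r * Suc T))
        \<le> (\<Sum>X\<le>r. (card V * (2 * ?a) ^ T * (2 * ?b T) ^ r) * p ^ Suc (r * Suc T))"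
    \<comment> \<open>Replacing the exponent \<open>X\<close> by \<open>r\<close> is monotone
      because \<open>D \<ge> 1\<close> makes the base at least 1.\<close>
    proof (intro sum_mono mult_right_mono)
      fix X assume X: "X \<in> {..r}"
      have "card (states T X) \<le> card V * (2 * ?a) ^ T * (2 * ?b T) ^ X"
        using card_states_le[of T T X] X by simp
      also have "\<dots> \<le> card V * (2 * ?a) ^ T * (2 * ?b T) ^ r"
        using X b by (intro mult_left_mono power_increasing) auto
      finally show "real (card (states T X)) \<le> real (card V * (2 * ?a) ^ T * (2 * ?b T) ^ r)"
        using of_nat_mono by blast
    qed (use p in auto)
    also have "\<dots> = real (Suc r * (2 * ?b T) ^ r) * ((card V * p ^ Suc r) * (2 * ?a * p ^ r) ^ T)"
      unfolding sum_constant card_atMost pow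
      by (simp only: of_nat_mult of_nat_power power_mult_distrib mult_ac)
    also have "\<dots> \<le> (K * 2 ^ T) * ((card V * p ^ Suc r) * (1 / 4) ^ T)"
    proof (intro mult_mono mult_left_mono power_mono)
      show "real (Suc r * (2 * ?b T) ^ r) \<le> K * 2 ^ T" using K[of T] .
      show "real (2 * ?a) * p ^ r \<le> 1 / 4" using sub by (simp add: power2_eq_square algebra_simps)
    qed (use p \<open>K \<ge> 0\<close> in auto)
    also have "\<dots> = K * (card V * p ^ Suc r) * (2 ^ T * (1 / 4) ^ T)" by simp
    also have "(2::real) ^ T * (1 / 4) ^ T = (1/2) ^ T" by (simp flip: power_mult_distrib)
    finally show ?thesis .
  qed
  then have "(\<Sum>T\<le>card V. \<Sum>X\<le>r. card (states T X) * p ^ Suc (r * Suc T))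
      \<le> (\<Sum>T\<le>card V. K * (card V * p ^ Suc r) * (1/2) ^ T)"
    by (rule sum_mono)
  also have "\<dots> = K * (card V * p ^ Suc r) * (\<Sum>T\<le>card V. (1/2) ^ T)"
    by (rule sum_distrib_left[symmetric])
  also have "\<dots> \<le> K * (card V * p ^ Suc r) * 2"
  proof (rule mult_left_mono)
    have "(\<Sum>T\<le>card V. (1/2::real) ^ T) \<le> (\<Sum>T. (1/2) ^ T)"
      by (intro sum_le_suminf) (auto intro: summable_geometric)
    then show "(\<Sum>T\<le>card V. (1/2::real) ^ T) \<le> 2" by (simp add: suminf_geometric)
  qed (use p \<open>K \<ge> 0\<close> in simp)
  finally show ?thesis
    using prob_not_choosable_le[OF p] by linarith
qed

end

section \<open>Choice of the constants and passage to the limit\<close>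

lemma codegree_le_max_codegree:
  assumes "finite (verts H)" "u \<in> verts H" "v \<in> verts H" "u \<noteq> v"
  shows "card {e \<in> edges H. u \<in> e \<and> v \<in> e} \<le> max_codegree H"
proof -
  let ?S = "{card {e \<in> edges H. u \<in> e \<and> v \<in> e} | u v. u \<in> verts H \<and> v \<in> verts H \<and> u \<noteq> v}"
  have "?S \<subseteq> (\<lambda>(u, v). card {e \<in> edges H. u \<in> e \<and> v \<in> e}) ` (verts H \<times> verts H)" by auto
  then have "finite ?S" using assms(1) by (meson finite_SigmaI finite_imageI finite_subset)
  then show ?thesis unfolding max_codegree_def using assms(2-4) by (intro Max_ge) auto
qed

text \<open>For fixed \<open>r\<close> and \<open>D\<close> the left side is polynomial in
  \<open>T\<close>, hence bounded after division by \<open>2 ^ T\<close>.\<close>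

lemma power_le_exponential:
  fixes r D :: nat
  obtains K :: real where
    "\<And>T. real (Suc r * (2 * ((1 + Suc r * (T + r))\<^sup>2 * D)) ^ r) \<le> K * 2 ^ T"
proof -
  let ?C = "Suc r * (2 * ((Suc r * Suc r)\<^sup>2 * D)) ^ r"
  have "(\<lambda>T. real (T + 1) ^ (2 * r) / 2 ^ T) \<longlonglongrightarrow> 0"
    by real_asymp
  then have "Bseq (\<lambda>T. real (T + 1) ^ (2 * r) / 2 ^ T)"
    by (intro convergent_imp_Bseq convergentI)
  then obtain K where K: "\<And>T. real (T + 1) ^ (2 * r) / 2 ^ T \<le> K"
    unfolding Bseq_def by (metis abs_le_D1 real_norm_def)
  have "real (Suc r * (2 * ((1 + Suc r * (T + r))\<^sup>2 * D)) ^ r) \<le> (?C * K) * 2 ^ T" for T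
  proof -
    have "1 + Suc r * (T + r) \<le> (Suc r * Suc r) * (T + 1)" by (simp add: algebra_simps)
    then have "Suc r * (2 * ((1 + Suc r * (T + r))\<^sup>2 * D)) ^ r
        \<le> Suc r * (2 * (((Suc r * Suc r) * (T + 1))\<^sup>2 * D)) ^ r"
      by (intro mult_left_mono mult_right_mono power_mono) auto
    also have "\<dots> = ?C * (T + 1) ^ (2 * r)"
      unfolding power_mult by (simp only: power_mult_distrib mult_ac)
    finally have "real (Suc r * (2 * ((1 + Suc r * (T + r))\<^sup>2 * D)) ^ r)
        \<le> real ?C * real (T + 1) ^ (2 * r)"
      by (metis of_nat_le_iff of_nat_mult of_nat_power)
    also have "\<dots> \<le> real ?C * (K * 2 ^ T)"
      using K[of T] by (intro mult_left_mono) (simp_all add: divide_le_eq)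
    finally show ?thesis by (simp add: mult_ac)
  qed
  then show ?thesis using that by blast
qed

theorem theorem1p7:
  fixes s :: nat and H :: "nat \<Rightarrow> 'a hypergraph"
  assumes "s \<ge> 3"
    and "\<And>n. finite_uniform_hypergraph s (H n)"
    and "filterlim (\<lambda>n. card (verts (H n))) at_top sequentially"
    and "(\<lambda>n. real (max_codegree (H n))) \<in> O(\<lambda>_. 1)"
  shows "\<exists>c::real. c > 0 \<and>
    (\<forall>p :: nat \<Rightarrow> real.
       (\<forall>n. 0 \<le> p n \<and> p n \<le> 1 \<and>
            p n \<le> c * real (card (verts (H n))) powr (- 1 / (real s - 1))) \<longrightarrow>
       (\<lambda>n. measure_pmf.prob (random_subset (verts (H n)) (p n))
              {W. choosable 2 (induced (H n) W)}) \<longlonglongrightarrow> 1)"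
proof -
  define r where "r = s - 1"
  have r: "s = Suc r" "r \<ge> 2" using assms(1) by (auto simp: r_def)
  let ?N = "\<lambda>n. card (verts (H n))"
  obtain C where C: "eventually (\<lambda>n. real (max_codegree (H n)) \<le> C) sequentially"
    using assms(4) by (auto elim!: landau_o.bigE)
  \<comment> \<open>The added 1 secures \<open>D \<ge> 1\<close> even when
    \<open>C \<le> 0\<close>.\<close>
  define D where "D = nat \<lceil>C\<rceil> + 1"
  have D: "D \<ge> 1" "C \<le> real D" unfolding D_def by (simp, linarith)
  obtain K where K: "\<And>T. real (Suc r * (2 * ((1 + Suc r * (T + r))\<^sup>2 * D)) ^ r) \<le> K * 2 ^ T"
    using power_le_exponential[of r D] by blast
  have "K \<ge> 0"
    using order_trans[OF of_nat_0_le_iff K[of 0]] by simp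
  \<comment> \<open>Chosen so that \<open>card V * p ^ r \<le> c\<close> is exactly the condition
    \<open>sub\<close> of the geometric bound.\<close>
  define c where "c = 1 / (8 * (real (Suc r))\<^sup>2 * D)"
  have c: "c > 0" using D by (simp add: c_def)
  have "8 * (real (Suc r))\<^sup>2 * D \<ge> 8 * 1 * 1"
    using D by (intro mult_mono) auto
  then have c1: "c \<le> 1" unfolding c_def by (subst divide_le_eq_1) auto
  show ?thesis
  proof (intro exI[of _ c] conjI allI impI c)
    fix p :: "nat \<Rightarrow> real"
    assume p: "\<forall>n. 0 \<le> p n \<and> p n \<le> 1 \<and> p n \<le> c * real (?N n) powr (- 1 / (real s - 1))"
    let ?P = "\<lambda>n. measure_pmf.prob (random_subset (verts (H n)) (p n))"
    let ?G = "\<lambda>n. {W. choosable 2 (induced (H n) W)}"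
    have N: "filterlim (\<lambda>n. real (?N n)) at_top sequentially"
      using assms(3) by (rule filterlim_compose[OF filterlim_real_sequentially])
    \<comment> \<open>With \<open>N\<close> vertices, the failure probability is at most
      \<open>2 * K * (N * p ^ r) * p\<close>. The factor \<open>N * p ^ r\<close> is at most 1, and
      the remaining \<open>p\<close> is at most \<open>N powr (- 1 / r)\<close>, which tends to
      0.\<close>
    have bound: "1 - 2 * K * real (?N n) powr (- 1 / r) \<le> ?P n (?G n)"
      if large: "?N n > 0" and codeg: "real (max_codegree (H n)) \<le> C" for n
    proof -
      have fin: "finite_uniform_hypergraph s (H n)" using assms(2) .
      interpret bounded_codegree "verts (H n)" "edges (H n)" r D
      proof
        fix u v assume "u \<in> verts (H n)" "v \<in> verts (H n)" "u \<noteq> v"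
        then have "card {e \<in> edges (H n). u \<in> e \<and> v \<in> e} \<le> max_codegree (H n)"
          using fin by (intro codegree_le_max_codegree) (auto simp: finite_uniform_hypergraph_def)
        then show "card {e \<in> edges (H n). u \<in> e \<and> v \<in> e} \<le> D" using codeg D by linarith
      qed (use fin r in \<open>auto simp: finite_uniform_hypergraph_def\<close>)
      let ?q = "real (?N n) powr (- 1 / r)"
      have pn: "0 \<le> p n" "p n \<le> 1" "p n \<le> c * ?q" using p r by auto
      have "p n ^ r \<le> (c * ?q) ^ r" using pn by (intro power_mono)
      also have "\<dots> = c ^ r * ?q ^ r" by (simp add: power_mult_distrib)
      also have "c ^ r \<le> c" using c c1 r power_decreasing[of 1 r c] by simp
      also have "?q ^ r = ?q powr r"
        using large by (simp add: powr_realpow)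
      also have "\<dots> = ?N n powr (- 1 / r * r)" by (rule powr_powr)
      also have "\<dots> = 1 / ?N n"
        using large r by (simp add: powr_minus_divide)
      finally have Np: "?N n * p n ^ r \<le> c"
        using large c by (simp add: field_simps)
      have "?P n {U. \<not> choosable 2 (U, {e \<in> edges (H n). e \<subseteq> U})} \<le> 2 * K * (?N n * p n ^ Suc r)"
      proof (rule prob_not_choosable_le_geometric[OF pn(1,2) D(1) _ K])
        have "8 * (real (Suc r))\<^sup>2 * D * (?N n * p n ^ r) \<le> 8 * (real (Suc r))\<^sup>2 * D * c"
          using Np by (intro mult_left_mono) auto
        also have "\<dots> = 1" using D by (simp add: c_def)
        finally show "8 * (real (Suc r))\<^sup>2 * D * (?N n * p n ^ r) \<le> 1" .
      qed
      also have "?N n * p n ^ Suc r = (?N n * p n ^ r) * p n" by simp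
      also have "\<dots> \<le> 1 * ?q"
      proof (intro mult_mono)
        show "p n \<le> ?q" using pn(3) mult_right_mono[OF c1, of ?q] by simp
      qed (use Np c1 pn in auto)
      finally have "?P n {U. \<not> choosable 2 (U, {e \<in> edges (H n). e \<subseteq> U})} \<le> 2 * K * ?q"
        using \<open>K \<ge> 0\<close> by (simp add: mult_left_mono)
      moreover have "?P n {U. \<not> choosable 2 (U, {e \<in> edges (H n). e \<subseteq> U})} = 1 - ?P n (?G n)"
        using measure_pmf.prob_compl[of "?G n" "random_subset (verts (H n)) (p n)"]
        by (simp add: induced_def Compl_eq_Diff_UNIV[symmetric] Collect_neg_eq)
      ultimately show ?thesis by linarith
    qed
    have "eventually (\<lambda>n. ?N n > 0) sequentially"
      using eventually_compose_filterlim[OF eventually_gt_at_top assms(3)] .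
    with C have "eventually (\<lambda>n. 1 - 2 * K * real (?N n) powr (- 1 / r) \<le> ?P n (?G n)) sequentially"
      by eventually_elim (rule bound)
    moreover have "(\<lambda>n. real (?N n) powr (- 1 / r)) \<longlonglongrightarrow> 0"
      using r by (intro tendsto_neg_powr[OF _ N]) simp
    then have "(\<lambda>n. 1 - 2 * K * real (?N n) powr (- 1 / r)) \<longlonglongrightarrow> 1 - 2 * K * 0"
      by (intro tendsto_intros)
    ultimately show "(\<lambda>n. ?P n (?G n)) \<longlonglongrightarrow> 1"
      by (rule_tac tendsto_sandwich[where h = "\<lambda>_. 1"]) auto
  qed
qed

end
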